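(* Assume that every limit cardinal is a strong limit cardinal. Then there is an unbounded class $\mathfrak{C}$ of singular cardinals (i.e. for every cardinal $\kappa_0$ some member of $\mathfrak{C}$ exceeds $\kappa_0$) such that: ($\aleph$) if $\aleph_\delta\in\mathfrak{C}$ and $\mathfrak{a}\subseteq\mathrm{Reg}\cap\aleph_\delta$ is progressive then $|pcf(\mathfrak{a})|<|\mathfrak{a}|^{+3}$; ($\beth$) if $\aleph_\delta\in\mathfrak{C}$ then $2^{\aleph_\delta}<\aleph_{(|\delta|^{+3})}$.
   Context: $\mathrm{Reg}$ is the class of regular cardinals. A set $\mathfrak{a}$ of regular cardinals is progressive if $|\mathfrak{a}|<\min(\mathfrak{a})$. For an ideal $\mathcal{J}$ on $\mathfrak{a}$ and $f,g\in\prod\mathfrak{a}$, $f<_{\mathcal{J}}g$ iff $\{\theta\in\mathfrak{a}\mid f(\theta)\ge g(\theta)\}\in\mathcal{J}$; $tcf(\prod\mathfrak{a},\mathcal{J})$ is the least length of a $<_{\mathcal{J}}$-increasing cofinal sequence in $\prod\mathfrak{a}$, when one exists; $pcf(\mathfrak{a})$ is the set of all such true cofinalities over proper ideals $\mathcal{J}$ on $\mathfrak{a}$. *)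

theory Defs
  imports "HOL-Library.Equipollence" "HOL-Library.FuncSet"
begin

text \<open>
  The universe of sets is a type of the following class: every element is a set, with
  \<open>elts x\<close> the collection of its members. HOL sets of type \<open>'a set\<close> play the role of classes,
  and the axiom schemes of Separation and Replacement range over all HOL predicates and functions
  on the universe. The Axiom of Choice need not be listed, since Replacement applied to
  a choice function provided by HOL yields it. By Separation and Replacement, every subclass of a
  set and every function whose domain is a set is again a set, so ideals, functions and sequences
  below are HOL sets and HOL functions.
\<close>

class zfc =
  fixes elts :: "'a \<Rightarrow> 'a set"
  assumes extensionality: "elts x = elts y \<Longrightarrow> x = y"
    and foundation: "wf {(x, y). x \<in> elts y}"
    and separation: "\<exists>z. elts z = {u \<in> elts x. P u}"
    and pairing: "\<exists>z. elts z = {x, y}"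
    and union: "\<exists>z. elts z = (\<Union>y \<in> elts x. elts y)"
    and power_set: "\<exists>z. elts z = {y. elts y \<subseteq> elts x}"
    and replacement: "\<exists>z. elts z = F ` elts x"
    and infinity: "\<exists>z. (\<exists>e \<in> elts z. elts e = {}) \<and>
                       (\<forall>u \<in> elts z. \<exists>v \<in> elts z. elts v = insert u (elts u))"

subsection \<open>Ordinals and cardinals\<close>

text \<open>Von Neumann ordinals, ordered by membership.\<close>

definition Ord :: "'a::zfc \<Rightarrow> bool" where
  "Ord x \<longleftrightarrow> (\<forall>y \<in> elts x. elts y \<subseteq> elts x) \<and> (\<forall>y \<in> elts x. \<forall>z \<in> elts y. elts z \<subseteq> elts y)"

abbreviation ord_less :: "'a::zfc \<Rightarrow> 'a \<Rightarrow> bool" (infix "\<sqsubset>" 50) where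
  "\<alpha> \<sqsubset> \<beta> \<equiv> \<alpha> \<in> elts \<beta>"

abbreviation ord_le :: "'a::zfc \<Rightarrow> 'a \<Rightarrow> bool" (infix "\<sqsubseteq>" 50) where
  "\<alpha> \<sqsubseteq> \<beta> \<equiv> \<alpha> \<sqsubset> \<beta> \<or> \<alpha> = \<beta>"

text \<open>The least ordinal with a property (unspecified if there is none).\<close>

definition ord_Least :: "('a::zfc \<Rightarrow> bool) \<Rightarrow> 'a" where
  "ord_Least P = (THE \<alpha>. Ord \<alpha> \<and> P \<alpha> \<and> (\<forall>\<beta>. \<beta> \<sqsubset> \<alpha> \<longrightarrow> \<not> P \<beta>))"

definition Card :: "'a::zfc \<Rightarrow> bool" where
  "Card \<kappa> \<longleftrightarrow> Ord \<kappa> \<and> (\<forall>\<alpha>. \<alpha> \<sqsubset> \<kappa> \<longrightarrow> \<not> elts \<alpha> \<approx> elts \<kappa>)"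

definition InfCard :: "'a::zfc \<Rightarrow> bool" where
  "InfCard \<kappa> \<longleftrightarrow> Card \<kappa> \<and> infinite (elts \<kappa>)"

text \<open>Meaningful when \<open>A\<close> is (the extension of) a set rather than a proper class.\<close>

definition cardinality :: "'a::zfc set \<Rightarrow> 'a" where
  "cardinality A = ord_Least (\<lambda>\<alpha>. elts \<alpha> \<approx> A)"

definition card_succ :: "'a::zfc \<Rightarrow> 'a" where
  "card_succ \<kappa> = ord_Least (\<lambda>\<mu>. Card \<mu> \<and> \<kappa> \<sqsubset> \<mu>)"

definition two_pow :: "'a::zfc \<Rightarrow> 'a" where
  "two_pow \<kappa> = cardinality {x. elts x \<subseteq> elts \<kappa>}"

text \<open>The increasing enumeration of the infinite cardinals; its value at a non-ordinal
  carries no meaning.\<close>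

function aleph :: "'a::zfc \<Rightarrow> 'a" where
  "aleph \<alpha> = ord_Least (\<lambda>\<kappa>. InfCard \<kappa> \<and> (\<forall>\<beta> \<in> elts \<alpha>. aleph \<beta> \<sqsubset> \<kappa>))"
  by auto
termination
  by (relation "{(x, y). x \<in> elts y}") (use foundation in auto)

declare aleph.simps [simp del]

definition cofinality :: "'a::zfc \<Rightarrow> 'a" where
  "cofinality \<alpha> = ord_Least (\<lambda>\<beta>. \<exists>f. f ` elts \<beta> \<subseteq> elts \<alpha> \<and>
                                     (\<forall>\<gamma> \<in> elts \<alpha>. \<exists>\<xi> \<in> elts \<beta>. \<gamma> \<sqsubseteq> f \<xi>))"

definition Reg :: "'a::zfc set" where
  "Reg = {\<kappa>. InfCard \<kappa> \<and> cofinality \<kappa> = \<kappa>}"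

definition singular_cardinal :: "'a::zfc \<Rightarrow> bool" where
  "singular_cardinal \<kappa> \<longleftrightarrow> InfCard \<kappa> \<and> cofinality \<kappa> \<sqsubset> \<kappa>"

text \<open>\<open>\<aleph>\<^sub>0\<close> counts as a limit cardinal; it is also a strong limit cardinal.\<close>

definition limit_cardinal :: "'a::zfc \<Rightarrow> bool" where
  "limit_cardinal \<kappa> \<longleftrightarrow> InfCard \<kappa> \<and> (\<forall>\<mu>. Card \<mu> \<and> \<mu> \<sqsubset> \<kappa> \<longrightarrow> card_succ \<mu> \<sqsubset> \<kappa>)"

definition strong_limit_cardinal :: "'a::zfc \<Rightarrow> bool" where
  "strong_limit_cardinal \<kappa> \<longleftrightarrow> InfCard \<kappa> \<and> (\<forall>\<mu>. Card \<mu> \<and> \<mu> \<sqsubset> \<kappa> \<longrightarrow> two_pow \<mu> \<sqsubset> \<kappa>)"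

subsection \<open>Possible cofinalities\<close>

text \<open>The empty set, which has no minimum, is counted as progressive.\<close>

definition progressive :: "'a::zfc set \<Rightarrow> bool" where
  "progressive A \<longleftrightarrow> A \<subseteq> Reg \<and> (A = {} \<or> cardinality A \<sqsubset> ord_Least (\<lambda>\<theta>. \<theta> \<in> A))"

definition ideal_on :: "'a set \<Rightarrow> 'a set set \<Rightarrow> bool" where
  "ideal_on A J \<longleftrightarrow> J \<subseteq> Pow A \<and> {} \<in> J \<and>
     (\<forall>X \<in> J. \<forall>Y. Y \<subseteq> X \<longrightarrow> Y \<in> J) \<and> (\<forall>X \<in> J. \<forall>Y \<in> J. X \<union> Y \<in> J)"

definition proper_ideal_on :: "'a set \<Rightarrow> 'a set set \<Rightarrow> bool" where
  "proper_ideal_on A J \<longleftrightarrow> ideal_on A J \<and> A \<notin> J"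

abbreviation product :: "'a::zfc set \<Rightarrow> ('a \<Rightarrow> 'a) set" where
  "product A \<equiv> Pi\<^sub>E A elts"

definition less_mod :: "'a::zfc set \<Rightarrow> 'a set set \<Rightarrow> ('a \<Rightarrow> 'a) \<Rightarrow> ('a \<Rightarrow> 'a) \<Rightarrow> bool" where
  "less_mod A J f g \<longleftrightarrow> {\<theta> \<in> A. g \<theta> \<sqsubseteq> f \<theta>} \<in> J"

text \<open>\<open>F\<close> restricted to the ordinal \<open>\<alpha>\<close> is a sequence of length \<open>\<alpha>\<close> that is increasing and
  cofinal in the product modulo \<open>J\<close>.\<close>

definition increasing_cofinal ::
    "'a::zfc set \<Rightarrow> 'a set set \<Rightarrow> 'a \<Rightarrow> ('a \<Rightarrow> 'a \<Rightarrow> 'a) \<Rightarrow> bool" where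
  "increasing_cofinal A J \<alpha> F \<longleftrightarrow>
     (\<forall>\<xi> \<in> elts \<alpha>. F \<xi> \<in> product A) \<and>
     (\<forall>\<xi> \<in> elts \<alpha>. \<forall>\<eta> \<in> elts \<xi>. less_mod A J (F \<eta>) (F \<xi>)) \<and>
     (\<forall>g \<in> product A. \<exists>\<xi> \<in> elts \<alpha>. less_mod A J g (F \<xi>))"

definition has_tcf :: "'a::zfc set \<Rightarrow> 'a set set \<Rightarrow> bool" where
  "has_tcf A J \<longleftrightarrow> (\<exists>\<alpha> F. Ord \<alpha> \<and> increasing_cofinal A J \<alpha> F)"

definition tcf :: "'a::zfc set \<Rightarrow> 'a set set \<Rightarrow> 'a" where
  "tcf A J = ord_Least (\<lambda>\<alpha>. \<exists>F. increasing_cofinal A J \<alpha> F)"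

definition pcf :: "'a::zfc set \<Rightarrow> 'a set" where
  "pcf A = {tcf A J | J. proper_ideal_on A J \<and> has_tcf A J}"

end

theory Submission
  imports Defs
begin

text \<open>
  Since the limit cardinal \<open>\<aleph>\<^sub>\<nu>\<close> with \<open>\<nu> = |\<delta>|\<^sup>+\<^sup>+\<^sup>+\<close> exceeds \<open>\<aleph>\<^sub>\<delta>\<close> for infinite \<open>\<delta>\<close>, it also
  exceeds the power of \<open>\<aleph>\<^sub>\<delta>\<close>; so \<open>C\<close> may consist of all singular cardinals above some \<open>\<aleph>\<^sub>w\<close> with
  \<open>w\<close> infinite.

  The hypothesis even gives \<open>|pcf A| \<le> |A|\<close> for every set \<open>A\<close> of regular cardinals. If \<open>\<lambda> = tcf A J\<close>
  is not in \<open>A\<close>, then by regularity \<open>J\<close> contains the part of \<open>A\<close> above \<open>\<lambda>\<close>, so a cofinal sequence of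
  length \<open>\<lambda>\<close> stays injective when restricted to \<open>A \<inter> \<lambda>\<close>. If \<open>A\<close> is finite, one coordinate
  \<open>\<theta> < \<lambda>\<close> already is injective, which is absurd. If \<open>A\<close> is infinite, the map \<open>\<lambda> \<mapsto> A \<inter> \<lambda>\<close> takes at
  most \<open>|A|\<close> values, and each fibre is countable: with \<open>\<lambda>\<^sub>1\<close> its least element, any other element
  \<open>\<lambda>\<close> satisfies \<open>\<lambda> \<le> |\<Prod>(A \<inter> \<lambda>\<^sub>1)| \<le> two_pow \<lambda>\<^sub>1\<close>, which is below the least limit cardinal above \<open>\<lambda>\<^sub>1\<close>.
\<close>

unbundle cardinal_syntax

section \<open>Sets and ordinals\<close>

lemma mem_irrefl: "\<not> (x::'a::zfc) \<sqsubset> x"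
  using foundation wf_not_refl by fastforce

lemma mem_asym: "(x::'a::zfc) \<sqsubset> y \<Longrightarrow> \<not> y \<sqsubset> x"
  using wf_not_sym[OF foundation] by fastforce

lemma mem_induct: "(\<And>x. (\<And>y. y \<sqsubset> x \<Longrightarrow> P y) \<Longrightarrow> P x) \<Longrightarrow> P (a::'a::zfc)"
  using wf_induct[OF foundation, of P a] by auto

text \<open>HOL sets over the universe stand for classes; this predicate singles out the sets, for
  which suprema of ordinals and cardinalities are available.\<close>

definition small :: "'a::zfc set \<Rightarrow> bool" where
  "small A \<longleftrightarrow> (\<exists>x. elts x = A)"

lemma small_elts: "small (elts (x::'a::zfc))"
  by (auto simp: small_def)

lemma small_image: "small A \<Longrightarrow> small (F ` A)" for F :: "'a::zfc \<Rightarrow> 'a"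
  using replacement[of F] by (auto simp: small_def)

lemma small_subset:
  assumes "small A" "B \<subseteq> A"
  shows "small (B::'a::zfc set)"
proof -
  obtain x where "elts x = A" using assms(1) by (auto simp: small_def)
  moreover obtain z where "elts z = {u \<in> elts x. u \<in> B}" using separation[of x "\<lambda>u. u \<in> B"] by blast
  ultimately have "elts z = B" using assms(2) by auto
  then show ?thesis by (auto simp: small_def)
qed

text \<open>Replacement applies to a map on \<open>A\<close> whose image covers
  \<open>B\<close>.\<close>

lemma small_lepoll:
  fixes A B :: "'a::zfc set"
  assumes "small A" "B \<lesssim> A"
  shows "small B"
proof -
  obtain g where "B \<subseteq> g ` A" using assms(2) by (auto simp: lepoll_iff)
  then show ?thesis using small_subset[OF small_image[OF assms(1), of g]] by blast
qed

lemma Ord_in_Ord: "Ord x \<Longrightarrow> y \<sqsubset> x \<Longrightarrow> Ord y"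
  unfolding Ord_def by blast

lemma Ord_trans: "Ord z \<Longrightarrow> x \<sqsubset> y \<Longrightarrow> y \<sqsubset> z \<Longrightarrow> x \<sqsubset> z"
  unfolding Ord_def by blast

text \<open>Nested membership induction: if \<open>a\<close> and \<open>b\<close> are incomparable,
  the two induction hypotheses put the elements of each into the other, and extensionality makes
  them equal.\<close>

lemma Ord_linear:
  assumes "Ord a" "Ord b"
  shows "a \<sqsubset> b \<or> a = b \<or> b \<sqsubset> a"
  using assms
proof (induction a arbitrary: b rule: mem_induct)
  case (1 a)
  note IHa = 1
  from \<open>Ord b\<close> show ?case
  proof (induction b rule: mem_induct)
    case (1 b)
    have "elts a = elts b" if "\<not> a \<sqsubset> b" "\<not> b \<sqsubset> a"
    proof
      show "elts a \<subseteq> elts b"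
        using IHa that \<open>Ord b\<close> by (metis Ord_in_Ord Ord_trans subsetI)
      show "elts b \<subseteq> elts a"
        using 1 that IHa by (metis Ord_in_Ord Ord_trans subsetI)
    qed
    then show ?case using extensionality by blast
  qed
qed

lemma Ord_subset_iff: "Ord a \<Longrightarrow> Ord b \<Longrightarrow> elts a \<subseteq> elts b \<longleftrightarrow> a \<sqsubseteq> b"
  using Ord_linear[of a b] mem_irrefl Ord_trans by blast

lemma Ord_not_less: "Ord a \<Longrightarrow> Ord b \<Longrightarrow> \<not> a \<sqsubset> b \<longleftrightarrow> b \<sqsubseteq> a"
  using Ord_linear mem_irrefl mem_asym by blast

lemma Ord_le_less_trans: "Ord c \<Longrightarrow> a \<sqsubseteq> b \<Longrightarrow> b \<sqsubset> c \<Longrightarrow> a \<sqsubset> c"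
  using Ord_trans by blast

lemma Ord_less_le_trans: "Ord c \<Longrightarrow> a \<sqsubset> b \<Longrightarrow> b \<sqsubseteq> c \<Longrightarrow> a \<sqsubset> c"
  using Ord_trans by blast

lemma Ord_le_trans: "Ord c \<Longrightarrow> a \<sqsubseteq> b \<Longrightarrow> b \<sqsubseteq> c \<Longrightarrow> a \<sqsubseteq> c"
  using Ord_trans by blast

lemma ex_least:
  assumes "P (a::'a::zfc)"
  shows "\<exists>b. P b \<and> (\<forall>c. c \<sqsubset> b \<longrightarrow> \<not> P c)"
  using assms by (induction a rule: mem_induct) blast

lemma ord_Least:
  assumes "Ord a" "P a"
  shows Ord_ord_Least: "Ord (ord_Least P)"
    and ord_LeastI: "P (ord_Least P)"
    and not_less_ord_Least: "\<And>b. b \<sqsubset> ord_Least P \<Longrightarrow> \<not> P b"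
proof -
  obtain m where m: "Ord m" "P m" "\<forall>c. c \<sqsubset> m \<longrightarrow> \<not> P c"
    using ex_least[of "\<lambda>x. Ord x \<and> P x" a] assms Ord_in_Ord by blast
  then have "ord_Least P = m"
    unfolding ord_Least_def using Ord_linear by (intro the_equality) blast+
  with m show "Ord (ord_Least P)" "P (ord_Least P)" "\<And>b. b \<sqsubset> ord_Least P \<Longrightarrow> \<not> P b"
    by auto
qed

lemma ord_Least_le:
  assumes "Ord a" "P a"
  shows "ord_Least P \<sqsubseteq> a"
  using Ord_linear[of a "ord_Least P"] ord_Least[of a P] assms by blast

lemma ex_Ord_above:
  assumes "small A" "\<And>x. x \<in> A \<Longrightarrow> Ord x"
  shows "\<exists>b. Ord b \<and> (\<forall>x \<in> A. x \<sqsubset> b)"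
proof -
  obtain a where a: "elts a = A" using assms(1) by (auto simp: small_def)
  obtain s where s: "elts s = (\<Union>y \<in> elts a. elts y)" using union by blast
  \<comment> \<open>Two pairings and a union form the successor of the supremum \<open>s\<close>,
    which lies strictly above all of \<open>A\<close>.\<close>
  obtain p where p: "elts p = {s}" using pairing[of s s] by auto
  obtain q where q: "elts q = {s, p}" using pairing by blast
  obtain b where b: "elts b = (\<Union>y \<in> elts q. elts y)" using union by blast
  have b': "elts b = insert s (elts s)" using b q p by auto
  have Os: "Ord s" using assms(2) a unfolding Ord_def s by blast
  have Ob: "Ord b" using Os unfolding Ord_def b' by blast
  have "x \<sqsubset> b" if "x \<in> A" for x
  proof -
    have "elts x \<subseteq> elts s" using that a s by blast
    then show ?thesis using Ord_subset_iff assms(2) that Os b' by blast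
  qed
  with Ob show ?thesis by blast
qed

lemma ex_Ord_Sup:
  assumes "small A" "\<And>x. x \<in> A \<Longrightarrow> Ord x"
  shows "\<exists>s. Ord s \<and> elts s = (\<Union>x \<in> A. elts x)"
proof -
  obtain a where a: "elts a = A" using assms(1) by (auto simp: small_def)
  obtain s where s: "elts s = (\<Union>y \<in> elts a. elts y)" using union by blast
  have "Ord s" using assms(2) a unfolding Ord_def s by blast
  with s a show ?thesis by blast
qed

text \<open>Burali-Forti: a strict upper bound of all ordinals would be a member of itself.\<close>

lemma Ords_not_small: "\<not> small {a::'a::zfc. Ord a}"
  using ex_Ord_above[of "{a::'a. Ord a}"] mem_irrefl by blast

section \<open>Counting sets by ordinals\<close>

definition ord_rel :: "('a::zfc \<times> 'a) set" where
  "ord_rel = {(a, b). Ord a \<and> Ord b \<and> a \<sqsubseteq> b}"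

lemma Field_ord_rel: "Field ord_rel = {a. Ord a}"
  by (auto simp: ord_rel_def Field_def)

lemma Well_order_ord_rel: "Well_order (ord_rel :: ('a::zfc \<times> 'a) set)"
proof -
  have "ord_rel - Id \<subseteq> {(x::'a, y). x \<in> elts y}" by (auto simp: ord_rel_def)
  then have "wf ((ord_rel :: ('a \<times> 'a) set) - Id)" using foundation wf_subset by blast
  moreover have "Linear_order (ord_rel :: ('a \<times> 'a) set)"
    unfolding linear_order_on_def partial_order_on_def preorder_on_def Field_ord_rel
    unfolding refl_on_def trans_def antisym_def total_on_def
    using Ord_linear Ord_trans mem_asym by (auto simp: ord_rel_def) blast+
  ultimately show ?thesis by (simp add: well_order_on_def)
qed

text \<open>Compared with a well-ordering of a set, the well-ordered class of all ordinals must be the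
  longer one, so that the set is counted by a proper initial segment, i.e. by an ordinal.\<close>

lemma ex_Ord_eqpoll:
  assumes "small (A::'a::zfc set)"
  shows "\<exists>a::'a. Ord a \<and> elts a \<approx> A"
proof -
  let ?R = "ord_rel :: ('a \<times> 'a) set"
  have "\<not> ?R \<le>o |A|"
  proof
    assume "?R \<le>o |A|"
    then have "|Field ?R| \<le>o |A|"
      by (metis card_of_mono2 Field_card_of)
    then have "{a::'a. Ord a} \<lesssim> A"
      by (simp add: Field_ord_rel lepoll_def card_of_ordLeq)
    then show False using assms small_lepoll Ords_not_small by blast
  qed
  then have "|A| <o ?R"
    using ordLess_or_ordLeq Well_order_ord_rel card_of_Well_order by blast
  then obtain a where a: "a \<in> Field ?R" "|A| =o Restr ?R (underS ?R a)"
    using ordLess_iff_ordIso_Restr Well_order_ord_rel card_of_Well_order by blast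
  \<comment> \<open>The strict predecessors of a von Neumann ordinal are its elements, so the
    initial segment found is the extension of a set.\<close>
  have u: "underS ?R a = elts a"
    using a(1) mem_irrefl Ord_in_Ord by (auto simp: underS_def ord_rel_def Field_def)
  have "Field (Restr ?R (elts a)) = elts a"
    using a(1) Ord_in_Ord by (auto simp: ord_rel_def Field_def)
  then have "|A| =o |elts a|"
    using card_of_cong[OF a(2)] u by (metis Field_card_of)
  then have "elts a \<approx> A" using eqpoll_iff_card_of_ordIso eqpoll_sym by blast
  with a(1) show ?thesis using Field_ord_rel by blast
qed

section \<open>Cardinals\<close>

lemma Card_Ord: "Card k \<Longrightarrow> Ord k"
  by (simp add: Card_def)

lemma InfCard_Card: "InfCard k \<Longrightarrow> Card k"
  by (simp add: InfCard_def)

lemma cardinality: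
  assumes "small (A::'a::zfc set)"
  shows Card_cardinality: "Card (cardinality A)"
    and cardinality_eqpoll: "elts (cardinality A) \<approx> A"
proof -
  obtain a :: 'a where a: "Ord a" "elts a \<approx> A" using ex_Ord_eqpoll assms by blast
  note L = ord_Least[of a "\<lambda>x. elts x \<approx> A", OF a]
  show "elts (cardinality A) \<approx> A" unfolding cardinality_def by (rule L(2))
  then show "Card (cardinality A)"
    unfolding Card_def cardinality_def using L eqpoll_trans by metis
qed

text \<open>By Schroeder-Bernstein, a smaller \<open>a\<close> would be equinumerous with
  \<open>k\<close>. This turns injections into the inequalities between cardinals needed
  below.\<close>

lemma Card_lepoll_imp_le:
  assumes "Card k" "Ord a" "elts k \<lesssim> elts a"
  shows "k \<sqsubseteq> a"
proof (rule ccontr)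
  assume "\<not> k \<sqsubseteq> a"
  then have "a \<sqsubset> k" using Ord_linear assms Card_Ord by blast
  moreover have "elts a \<subseteq> elts k"
    using calculation Ord_subset_iff assms Card_Ord by blast
  ultimately show False
    using assms by (metis Card_def lepoll_antisym subset_imp_lepoll)
qed

lemma cardinality_mono:
  assumes "small (B::'a::zfc set)" "A \<lesssim> B"
  shows "cardinality A \<sqsubseteq> cardinality B"
  using assms
  by (meson Card_Ord Card_cardinality Card_lepoll_imp_le cardinality_eqpoll eqpoll_sym
      lepoll_trans1 lepoll_trans2 small_lepoll)

lemma small_subsets: "small {x::'a::zfc. elts x \<subseteq> elts k}"
  using power_set by (auto simp: small_def)

text \<open>By Separation every HOL subset of a set is itself a set, so internal and external power
  sets agree through \<open>elts\<close>.\<close>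

lemma subsets_eqpoll_Pow: "{x::'a::zfc. elts x \<subseteq> elts k} \<approx> Pow (elts k)"
proof -
  have "bij_betw elts {x::'a. elts x \<subseteq> elts k} (Pow (elts k))"
    unfolding bij_betw_def inj_on_def
    using extensionality separation[of k] by (auto simp: image_iff) (metis Collect_mem_eq Int_absorb1 Int_def)
  then show ?thesis by (auto simp: eqpoll_def)
qed

lemma Card_two_pow: "Card (two_pow k)"
  by (simp add: two_pow_def Card_cardinality small_subsets)

lemma two_pow_eqpoll: "elts (two_pow k) \<approx> Pow (elts k)"
  unfolding two_pow_def using cardinality_eqpoll small_subsets subsets_eqpoll_Pow eqpoll_trans
  by blast

text \<open>By Cantor's theorem \<open>two_pow a\<close> is a witness.\<close>

lemma ex_Card_above:
  assumes "Ord (a::'a::zfc)"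
  shows "\<exists>k. Card k \<and> a \<sqsubset> k"
proof -
  have "\<not> two_pow a \<sqsubseteq> a"
  proof
    assume "two_pow a \<sqsubseteq> a"
    then have "elts (two_pow a) \<lesssim> elts a"
      using Ord_subset_iff Card_two_pow Card_Ord assms subset_imp_lepoll by blast
    then have "Pow (elts a) \<lesssim> elts a"
      using two_pow_eqpoll eqpoll_sym lepoll_trans1 by blast
    then show False using lesspoll_Pow_self lesspoll_trans2 by blast
  qed
  then show ?thesis using Ord_linear assms Card_two_pow Card_Ord by blast
qed

lemma card_succ:
  assumes "Ord (k::'a::zfc)"
  shows Card_card_succ: "Card (card_succ k)"
    and less_card_succ: "k \<sqsubset> card_succ k"
    and card_succ_le: "\<And>m. Card m \<Longrightarrow> k \<sqsubset> m \<Longrightarrow> card_succ k \<sqsubseteq> m"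
proof -
  obtain m where m: "Card m" "k \<sqsubset> m" using ex_Card_above assms by blast
  then show "Card (card_succ k)" "k \<sqsubset> card_succ k"
    unfolding card_succ_def using ord_LeastI[of m "\<lambda>\<mu>. Card \<mu> \<and> k \<sqsubset> \<mu>"] Card_Ord by blast+
  show "card_succ k \<sqsubseteq> m" if "Card m" "k \<sqsubset> m" for m
    unfolding card_succ_def using ord_Least_le[of m "\<lambda>\<mu>. Card \<mu> \<and> k \<sqsubset> \<mu>"] Card_Ord that by blast
qed

lemma Card_card_succ_funpow: "Card k \<Longrightarrow> Card ((card_succ ^^ n) k)"
  by (induction n) (auto simp: Card_card_succ Card_Ord)

lemma less_card_succ_funpow: "Card k \<Longrightarrow> k \<sqsubset> (card_succ ^^ Suc n) k"
proof (induction n)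
  case 0
  then show ?case by (simp add: less_card_succ Card_Ord)
next
  case (Suc n)
  then show ?case
    using less_card_succ[OF Card_Ord[OF Card_card_succ_funpow[of k "Suc n"]]]
      Ord_trans[OF Card_Ord[OF Card_card_succ_funpow[of k "Suc (Suc n)"]]] by simp
qed

lemma InfCard_mono:
  assumes "InfCard k" "Card m" "k \<sqsubseteq> m"
  shows "InfCard m"
proof -
  have "elts k \<subseteq> elts m"
    using assms Ord_subset_iff[of k m] InfCard_Card Card_Ord by blast
  with assms show ?thesis unfolding InfCard_def using finite_subset by blast
qed

lemma InfCard_card_succ: "InfCard k \<Longrightarrow> InfCard (card_succ k)"
  using InfCard_mono Card_card_succ less_card_succ Card_Ord InfCard_Card by blast

lemma InfCard_card_succ_funpow: "InfCard k \<Longrightarrow> InfCard ((card_succ ^^ n) k)"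
  by (induction n) (auto simp: InfCard_card_succ)

text \<open>On a finite set the converse of membership, being acyclic, is well-founded, so some
  element belongs to no other one; but its successor also lies in the set given by Infinity.\<close>

lemma ex_infinite_set: "\<exists>z::'a::zfc. infinite (elts z)"
proof -
  obtain z e where z: "e \<in> elts z"
      "\<forall>u \<in> elts z. \<exists>v \<in> elts z. elts v = insert u (elts (u::'a))"
    using infinity by blast
  have "infinite (elts z)"
  proof
    assume fin: "finite (elts z)"
    let ?r = "{(x, y). x \<in> elts y} \<inter> elts z \<times> elts z"
    have "acyclic ?r" using foundation wf_subset wf_acyclic by (metis inf_le1)
    moreover have "finite ?r" using fin by blast
    ultimately have "wf (?r\<inverse>)" using finite_acyclic_wf_converse by blast
    then obtain m where m: "m \<in> elts z" "\<forall>y. (y, m) \<in> ?r\<inverse> \<longrightarrow> y \<notin> elts z"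
      using z(1) unfolding wf_eq_minimal by blast
    then obtain v where v: "v \<in> elts z" "elts v = insert m (elts m)" using z(2) by blast
    then have "(v, m) \<in> ?r\<inverse>" using m(1) by simp
    with m(2) v(1) show False by blast
  qed
  then show ?thesis by blast
qed

text \<open>Such a \<open>w\<close> plays the role of \<omega> and carries HOL countability over to
  the universe.\<close>

lemma ex_countable_InfCard: "\<exists>w::'a::zfc. InfCard w \<and> elts w \<approx> (UNIV::nat set)"
proof -
  obtain z :: 'a where "infinite (elts z)" using ex_infinite_set by blast
  then obtain f :: "nat \<Rightarrow> 'a" where f: "inj f" "range f \<subseteq> elts z"
    using infinite_countable_subset by blast
  have s: "small (range f)" using f(2) small_elts small_subset by blast
  have "elts (cardinality (range f)) \<approx> (UNIV::nat set)"
    using cardinality_eqpoll[OF s] inj_on_image_eqpoll_self[OF f(1)] eqpoll_trans by blast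
  then show ?thesis
    using Card_cardinality[OF s] eqpoll_finite_iff infinite_UNIV_nat
    unfolding InfCard_def by blast
qed

text \<open>Infinite cardinals are limit ordinals: with a last element \<open>a\<close>, the
  cardinal would be the successor of the infinite \<open>a\<close> and hence equinumerous with
  it.\<close>

lemma InfCard_limit:
  assumes "InfCard k" "a \<sqsubset> k"
  shows "\<exists>b. a \<sqsubset> b \<and> b \<sqsubset> k"
proof (rule ccontr)
  assume no: "\<nexists>b. a \<sqsubset> b \<and> b \<sqsubset> k"
  have Ok: "Ord k" "Card k" using assms by (auto simp: InfCard_Card Card_Ord)
  have Oa: "Ord a" using Ok assms Ord_in_Ord by blast
  have eq: "elts k = insert a (elts a)"
  proof
    show "elts k \<subseteq> insert a (elts a)"
      using no Ord_linear[OF Oa] Ok(1) Ord_in_Ord by blast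
    show "insert a (elts a) \<subseteq> elts k"
      using assms(2) Ord_trans[OF Ok(1)] by blast
  qed
  then have "infinite (elts a)" using assms(1) by (auto simp: InfCard_def)
  then have "elts a \<approx> elts k" using infinite_insert_eqpoll eq eqpoll_sym by metis
  then show False using Ok assms(2) by (auto simp: Card_def)
qed

lemma infinite_Times_lepoll:
  assumes "infinite A"
  shows "A \<times> A \<lesssim> A"
  unfolding lepoll_def card_of_ordLeq
  using card_of_Times_same_infinite[OF assms] ordIso_iff_ordLeq by blast

subsection \<open>Alephs\<close>

text \<open>The minimum in the recursion exists: Replacement bounds the earlier alephs by an
  ordinal, and above that bound and \<open>w\<close> there is a cardinal.\<close>

lemma aleph:
  assumes "Ord (a::'a::zfc)"
  shows InfCard_aleph: "InfCard (aleph a)"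
    and aleph_less: "\<And>b. b \<sqsubset> a \<Longrightarrow> aleph b \<sqsubset> aleph a"
    and aleph_le: "\<And>k. InfCard k \<Longrightarrow> (\<And>b. b \<sqsubset> a \<Longrightarrow> aleph b \<sqsubset> k) \<Longrightarrow> aleph a \<sqsubseteq> k"
proof -
  let ?P = "\<lambda>\<kappa>. InfCard \<kappa> \<and> (\<forall>\<beta> \<in> elts a. aleph \<beta> \<sqsubset> \<kappa>)"
  have "InfCard (aleph a) \<and> (\<forall>b \<in> elts a. aleph b \<sqsubset> aleph a)"
    using assms
  proof (induction a rule: mem_induct)
    case (1 a)
    let ?P = "\<lambda>\<kappa>. InfCard \<kappa> \<and> (\<forall>\<beta> \<in> elts a. aleph \<beta> \<sqsubset> \<kappa>)"
    obtain w :: 'a where w: "InfCard w" using ex_countable_InfCard by blast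
    have "Ord x" if "x \<in> aleph ` elts a" for x
      using that 1 Ord_in_Ord InfCard_Card Card_Ord by blast
    then obtain b where b: "Ord b" "\<forall>x \<in> aleph ` elts a. x \<sqsubset> b"
      using ex_Ord_above[OF small_image[OF small_elts]] by blast
    obtain c where c: "Ord c" "w \<sqsubset> c" "b \<sqsubset> c"
    proof -
      have "Ord w" using w InfCard_Card Card_Ord by blast
      then show ?thesis
        using that b(1) ex_Card_above[of w] ex_Card_above[of b] Ord_linear[of w b]
          Card_Ord Ord_trans by metis
    qed
    obtain k where k: "Card k" "c \<sqsubset> k" using ex_Card_above c(1) by blast
    have Ok: "Ord k" using k Card_Ord by blast
    have "w \<sqsubset> k" "\<forall>\<beta> \<in> elts a. aleph \<beta> \<sqsubset> k"
      using Ord_trans[OF Ok] k(2) c Ord_trans[OF c(1)] b(2) by blast+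
    then have "?P k" using InfCard_mono w k(1) by blast
    then have "?P (ord_Least ?P)" using ord_LeastI[of k ?P] Ok by blast
    then show ?case by (subst (1 3) aleph.simps)
  qed
  then show "InfCard (aleph a)" "\<And>b. b \<sqsubset> a \<Longrightarrow> aleph b \<sqsubset> aleph a" by blast+
  show "aleph a \<sqsubseteq> k" if "InfCard k" "\<And>b. b \<sqsubset> a \<Longrightarrow> aleph b \<sqsubset> k" for k
    by (subst (1 2) aleph.simps, rule ord_Least_le) (use that InfCard_Card Card_Ord in blast)+
qed

lemma aleph_less_imp:
  assumes "Ord a" "Ord b" "aleph a \<sqsubset> aleph b"
  shows "a \<sqsubset> b"
  using assms Ord_linear aleph_less mem_asym mem_irrefl by metis

text \<open>A cardinal \<open>m\<close> below \<open>aleph n\<close> is below an earlier aleph,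
  which then bounds \<open>card_succ m\<close>. Otherwise all earlier alephs are at most
  \<open>m\<close>, even strictly below it since \<open>n\<close> is a limit ordinal, against the
  minimality of \<open>aleph n\<close>.\<close>

lemma limit_cardinal_aleph:
  assumes "InfCard n"
  shows "limit_cardinal (aleph n)"
  unfolding limit_cardinal_def
proof (intro conjI allI impI)
  have On: "Ord n" using assms InfCard_Card Card_Ord by blast
  show inf: "InfCard (aleph n)" using InfCard_aleph On by blast
  have Oa: "Ord (aleph n)" using inf InfCard_Card Card_Ord by blast
  fix m assume m: "Card m \<and> m \<sqsubset> aleph n"
  then have Om: "Ord m" using Card_Ord by blast
  have Ic: "InfCard (aleph c)" if "c \<sqsubset> n" for c
    using that On Ord_in_Ord InfCard_aleph by blast
  obtain c where c: "c \<sqsubset> n" "m \<sqsubset> aleph c"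
  proof (rule ccontr)
    assume "\<not> thesis"
    then have *: "aleph c \<sqsubseteq> m" if "c \<sqsubset> n" for c
      using \<open>\<And>c. c \<sqsubset> n \<Longrightarrow> m \<sqsubset> aleph c \<Longrightarrow> thesis\<close> that Ord_linear[OF Om] Ic InfCard_Card Card_Ord
      by blast
    have **: "aleph c \<sqsubset> m" if c: "c \<sqsubset> n" for c
    proof -
      obtain d where d: "c \<sqsubset> d" "d \<sqsubset> n" using InfCard_limit assms c by blast
      then have "aleph c \<sqsubset> aleph d" using aleph_less On Ord_in_Ord by blast
      then show ?thesis using *[OF d(2)] Ord_trans[OF Om] by blast
    qed
    obtain c where "c \<sqsubset> n" using assms unfolding InfCard_def by (metis ex_in_conv finite.emptyI)
    then have "InfCard m" using Ic * InfCard_mono m by blast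
    then have "aleph n \<sqsubseteq> m" using aleph_le On ** by blast
    then show False using m mem_irrefl mem_asym by blast
  qed
  then have "card_succ m \<sqsubseteq> aleph c" using card_succ_le Om Ic InfCard_Card by blast
  moreover have "aleph c \<sqsubset> aleph n" using c On aleph_less by blast
  ultimately show "card_succ m \<sqsubset> aleph n" by (rule Ord_le_less_trans[OF Oa])
qed

subsection \<open>Limits of successor cardinals\<close>

lemma small_countable:
  assumes "countable (A::'a::zfc set)"
  shows "small A"
proof -
  obtain w :: 'a where w: "elts w \<approx> (UNIV::nat set)" using ex_countable_InfCard by blast
  have "A \<lesssim> (UNIV::nat set)" using assms by (auto simp: countable_def lepoll_def)
  then have "A \<lesssim> elts w" using w eqpoll_sym lepoll_trans2 by blast
  then show ?thesis using small_lepoll[OF small_elts] by blast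
qed

text \<open>This supremum is the next limit cardinal after \<open>k\<close>: whatever lies below it
  lies below some iterate, which is itself a cardinal.\<close>

lemma ex_limit_cardinal_Sup:
  assumes "InfCard (k::'a::zfc)"
  shows "\<exists>m. limit_cardinal m \<and> elts m = (\<Union>n. elts ((card_succ ^^ n) k))"
proof -
  define c where "c n = (card_succ ^^ n) k" for n
  have Ic: "InfCard (c n)" for n using InfCard_card_succ_funpow assms by (simp add: c_def)
  have Cc: "Card (c n)" for n using Ic InfCard_Card by blast
  have Oc: "Ord (c n)" for n using Cc Card_Ord by blast
  have cS: "c n \<sqsubset> c (Suc n)" for n using less_card_succ[OF Oc[of n]] by (simp add: c_def)
  have "\<exists>m. Ord m \<and> elts m = (\<Union>x \<in> range c. elts x)"
    by (rule ex_Ord_Sup) (use Oc small_countable[of "range c"] in auto)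
  then obtain m where m: "Ord m" "elts m = (\<Union>n. elts (c n))" by auto
  have cm: "c n \<sqsubset> m" for n using cS[of n] m(2) by blast
  have "Card m"
    unfolding Card_def
  proof (intro conjI allI impI notI)
    show "Ord m" by fact
    fix a assume "a \<sqsubset> m" "elts a \<approx> elts m"
    then obtain n where n: "a \<sqsubset> c n" using m by blast
    have "elts (c n) \<lesssim> elts m" using m(2) by (intro subset_imp_lepoll) blast
    then have "elts (c n) \<lesssim> elts a" using \<open>elts a \<approx> elts m\<close> eqpoll_sym lepoll_trans2 by blast
    then have "c n \<sqsubseteq> a" using Card_lepoll_imp_le[OF Cc] \<open>a \<sqsubset> m\<close> m(1) Ord_in_Ord by blast
    then show False using n mem_irrefl mem_asym by blast
  qed
  then have "InfCard m" using InfCard_mono[OF Ic[of 0]] cm by blast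
  moreover have "card_succ l \<sqsubset> m" if l: "Card l" "l \<sqsubset> m" for l
  proof -
    obtain n where "l \<sqsubset> c n" using l(2) m(2) by blast
    then have "card_succ l \<sqsubseteq> c n" using card_succ_le[OF Card_Ord[OF l(1)] Cc] by blast
    then show ?thesis using cm by (rule Ord_le_less_trans[OF m(1)])
  qed
  ultimately have "limit_cardinal m" by (simp add: limit_cardinal_def)
  with m(2) show ?thesis by (auto simp: c_def)
qed

text \<open>No cardinal lies strictly between consecutive iterates of
  \<open>card_succ\<close>.\<close>

lemma Card_less_card_succ_funpow:
  assumes "Card k" "Card l" "k \<sqsubseteq> l" "l \<sqsubset> (card_succ ^^ n) k"
  shows "l \<in> range (\<lambda>n. (card_succ ^^ n) k)"
  using assms(4)
proof (induction n)
  case 0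
  then show ?case using assms(3) mem_irrefl mem_asym by (metis funpow_0)
next
  case (Suc n)
  let ?c = "(card_succ ^^ n) k"
  have Oc: "Ord ?c" "Ord l" using Card_card_succ_funpow assms Card_Ord by blast+
  have "\<not> ?c \<sqsubset> l"
  proof
    assume "?c \<sqsubset> l"
    then have "card_succ ?c \<sqsubseteq> l" using card_succ_le[OF Oc(1) assms(2)] by blast
    then show False using Suc.prems mem_irrefl mem_asym by auto
  qed
  then have "l \<sqsubset> ?c \<or> l = ?c" using Ord_linear[OF Oc] by blast
  then show ?case using Suc.IH by blast
qed

text \<open>Here the hypothesis enters the bound on \<open>pcf\<close>: the next limit cardinal
  after \<open>k\<close> is a strong limit, so \<open>two_pow k\<close> is passed after finitely
  many successor steps.\<close>

lemma countable_Card_interval: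
  assumes "\<forall>\<kappa>::'a::zfc. limit_cardinal \<kappa> \<longrightarrow> strong_limit_cardinal \<kappa>" "InfCard (k::'a)"
  shows "countable {l. Card l \<and> k \<sqsubseteq> l \<and> l \<sqsubseteq> two_pow k}"
proof -
  obtain m where m: "limit_cardinal m" "elts m = (\<Union>n. elts ((card_succ ^^ n) k))"
    using ex_limit_cardinal_Sup[OF assms(2)] by blast
  have Ck: "Card k" using assms(2) InfCard_Card by blast
  then have "k \<sqsubset> m" using less_card_succ_funpow[of k 0] m(2) by blast
  then have p: "two_pow k \<sqsubset> m"
    using m(1) assms(1) Ck by (auto simp: strong_limit_cardinal_def)
  have "Ord m" using m(1) by (auto simp: limit_cardinal_def InfCard_def Card_def)
  then have "{l. Card l \<and> k \<sqsubseteq> l \<and> l \<sqsubseteq> two_pow k} \<subseteq> range (\<lambda>n. (card_succ ^^ n) k)"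
    using Ord_le_less_trans[OF _ _ p] m(2) Card_less_card_succ_funpow[OF Ck] by blast
  then show ?thesis by (rule countable_subset) simp
qed

section \<open>Cofinality\<close>

lemma cofinality:
  assumes "Ord (a::'a::zfc)"
  shows Ord_cofinality: "Ord (cofinality a)"
    and ex_cofinal_map: "\<exists>f. f ` elts (cofinality a) \<subseteq> elts a \<and>
        (\<forall>g \<in> elts a. \<exists>x \<in> elts (cofinality a). g \<sqsubseteq> f x)"
    and less_cofinality_bounded: "\<And>b f. b \<sqsubset> cofinality a \<Longrightarrow> f ` elts b \<subseteq> elts a \<Longrightarrow>
        \<exists>g. g \<sqsubset> a \<and> (\<forall>x \<in> elts b. f x \<sqsubset> g)"
    and cofinality_le: "\<And>b f. Ord b \<Longrightarrow> f ` elts b \<subseteq> elts a \<Longrightarrow>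
        \<forall>g \<in> elts a. \<exists>x \<in> elts b. g \<sqsubseteq> f x \<Longrightarrow> cofinality a \<sqsubseteq> b"
proof -
  let ?P = "\<lambda>\<beta>. \<exists>f. f ` elts \<beta> \<subseteq> elts a \<and> (\<forall>\<gamma> \<in> elts a. \<exists>\<xi> \<in> elts \<beta>. \<gamma> \<sqsubseteq> f \<xi>)"
  have "?P a" by (rule exI[of _ id]) auto
  note L = ord_Least[of a ?P, OF assms this, folded cofinality_def]
  show "Ord (cofinality a)" by (rule L(1))
  show "?P (cofinality a)" by (rule L(2))
  show "cofinality a \<sqsubseteq> b" if "Ord b" "f ` elts b \<subseteq> elts a"
      "\<forall>g \<in> elts a. \<exists>x \<in> elts b. g \<sqsubseteq> f x" for b f
    unfolding cofinality_def using that by (intro ord_Least_le) blast+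
  show "\<exists>g. g \<sqsubset> a \<and> (\<forall>x \<in> elts b. f x \<sqsubset> g)"
    if b: "b \<sqsubset> cofinality a" "f ` elts b \<subseteq> elts a" for b f
  proof -
    obtain g where g: "g \<sqsubset> a" "\<forall>x \<in> elts b. \<not> g \<sqsubseteq> f x"
      using L(3)[OF b(1)] b(2) by blast
    have "f x \<sqsubset> g" if "x \<sqsubset> b" for x
    proof -
      have "Ord g" "Ord (f x)" using g(1) b(2) that assms Ord_in_Ord by blast+
      then show ?thesis using Ord_linear g(2) that by blast
    qed
    with g(1) show ?thesis by blast
  qed
qed

text \<open>A bijection from a smaller ordinal onto \<open>a\<close> would be bounded strictly below
  \<open>a\<close>, yet its bound is one of its values.\<close>

lemma Card_if_cofinality_eq:
  assumes "Ord a" "cofinality a = a"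
  shows "Card a"
  unfolding Card_def
proof (intro conjI allI impI notI)
  fix b assume b: "b \<sqsubset> a" "elts b \<approx> elts a"
  then obtain f where f: "f ` elts b = elts a" by (auto simp: eqpoll_def bij_betw_def)
  then obtain g where "g \<sqsubset> a" "\<forall>x \<in> elts b. f x \<sqsubset> g"
    using less_cofinality_bounded[of a b f] assms b(1) by auto
  then show False using f mem_irrefl by (metis imageE)
qed (fact assms(1))

text \<open>On an ordinal of length at most a cofinality, this turns a cofinal map into a strictly
  increasing cofinal one.\<close>

function strictify :: "('a::zfc \<Rightarrow> 'a) \<Rightarrow> 'a \<Rightarrow> 'a" where
  "strictify h x = ord_Least (\<lambda>e. h x \<sqsubseteq> e \<and> (\<forall>z \<in> elts x. strictify h z \<sqsubset> e))"
  by auto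
termination
  by (relation "inv_image {(x, y). x \<in> elts y} snd") (use foundation in auto)

declare strictify.simps [simp del]

text \<open>Fewer than \<open>cofinality a\<close> values precede stage \<open>x\<close>, so some
  \<open>g\<close> below \<open>a\<close> bounds them; the larger of \<open>g\<close> and
  \<open>h x\<close> keeps the least choice below \<open>a\<close>.\<close>

lemma strictify:
  assumes "Ord a" "h ` elts (cofinality a) \<subseteq> elts a" "x \<sqsubset> cofinality a"
  shows "strictify h x \<sqsubset> a" "h x \<sqsubseteq> strictify h x" "\<And>z. z \<sqsubset> x \<Longrightarrow> strictify h z \<sqsubset> strictify h x"
proof -
  let ?G = "strictify h"
  have "?G x \<sqsubset> a \<and> h x \<sqsubseteq> ?G x \<and> (\<forall>z \<in> elts x. ?G z \<sqsubset> ?G x)"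
    using assms(3)
  proof (induction x rule: mem_induct)
    case (1 x)
    let ?P = "\<lambda>e. h x \<sqsubseteq> e \<and> (\<forall>z \<in> elts x. ?G z \<sqsubset> e)"
    have "?G ` elts x \<subseteq> elts a" using 1 Ord_trans[OF Ord_cofinality[OF assms(1)]] by blast
    then obtain g where g: "g \<sqsubset> a" "\<forall>z \<in> elts x. ?G z \<sqsubset> g"
      using less_cofinality_bounded[OF assms(1) 1(2)] by blast
    have hx: "h x \<sqsubset> a" using assms(2) 1(2) by blast
    have O: "Ord g" "Ord (h x)" using g(1) hx assms(1) Ord_in_Ord by blast+
    have "\<exists>e. e \<sqsubset> a \<and> ?P e"
    proof (cases "h x \<sqsubset> g")
      case True
      then show ?thesis using g by blast
    next
      case False
      then have "g \<sqsubseteq> h x" using O Ord_not_less by blast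
      then have "?P (h x)" using g(2) Ord_less_le_trans[OF O(2)] by blast
      then show ?thesis using hx by blast
    qed
    then obtain e where e: "e \<sqsubset> a" "?P e" by blast
    then have "Ord e" using assms(1) Ord_in_Ord by blast
    note eq = strictify.simps[of h x, symmetric]
    have "?P (?G x)" using ord_LeastI[of e ?P, OF \<open>Ord e\<close> e(2)] unfolding eq .
    moreover have "?G x \<sqsubseteq> e" using ord_Least_le[of e ?P, OF \<open>Ord e\<close> e(2)] unfolding eq .
    ultimately show ?case using e(1) Ord_le_less_trans[OF assms(1)] by blast
  qed
  then show "?G x \<sqsubset> a" "h x \<sqsubseteq> ?G x" "\<And>z. z \<sqsubset> x \<Longrightarrow> ?G z \<sqsubset> ?G x" by blast+
qed

section \<open>Possible cofinalities\<close>

lemma Reg_InfCard: "\<theta> \<in> Reg \<Longrightarrow> InfCard \<theta>"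
  by (simp add: Reg_def)

lemma Reg_Ord: "\<theta> \<in> Reg \<Longrightarrow> Ord \<theta>"
  by (simp add: Reg_def InfCard_def Card_def)

lemma ideal_on_subset: "ideal_on A J \<Longrightarrow> X \<in> J \<Longrightarrow> Y \<subseteq> X \<Longrightarrow> Y \<in> J"
  by (auto simp: ideal_on_def)

lemma ideal_on_Un: "ideal_on A J \<Longrightarrow> X \<in> J \<Longrightarrow> Y \<in> J \<Longrightarrow> X \<union> Y \<in> J"
  by (auto simp: ideal_on_def)

text \<open>Used contrapositively: a finite set outside the ideal has a point whose singleton is
  outside it.\<close>

lemma ideal_on_finite:
  assumes "ideal_on A J" "finite B" "\<And>x. x \<in> B \<Longrightarrow> {x} \<in> J"
  shows "B \<in> J"
  using assms(2,3)
proof (induction B rule: finite_induct)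
  case empty
  then show ?case using assms(1) by (auto simp: ideal_on_def)
next
  case (insert x B)
  then show ?case using ideal_on_Un[OF assms(1), of "{x}" B] by auto
qed

lemma less_mod_trans:
  assumes "A \<subseteq> Reg" "ideal_on A J" "f \<in> product A" "g \<in> product A"
    and "less_mod A J f g" "less_mod A J g h"
  shows "less_mod A J f h"
proof -
  have "{\<theta> \<in> A. h \<theta> \<sqsubseteq> f \<theta>} \<subseteq> {\<theta> \<in> A. g \<theta> \<sqsubseteq> f \<theta>} \<union> {\<theta> \<in> A. h \<theta> \<sqsubseteq> g \<theta>}"
  proof
    fix \<theta> assume t: "\<theta> \<in> {\<theta> \<in> A. h \<theta> \<sqsubseteq> f \<theta>}"
    have O: "Ord (f \<theta>)" "Ord (g \<theta>)"
      using t assms(1,3,4) Reg_Ord Ord_in_Ord PiE_mem by blast+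
    have "h \<theta> \<sqsubseteq> g \<theta>" if "f \<theta> \<sqsubset> g \<theta>"
      using Ord_le_less_trans[OF O(2) _ that, of "h \<theta>"] t by blast
    then have "g \<theta> \<sqsubseteq> f \<theta> \<or> h \<theta> \<sqsubseteq> g \<theta>" using Ord_not_less[OF O] by metis
    then show "\<theta> \<in> {\<theta> \<in> A. g \<theta> \<sqsubseteq> f \<theta>} \<union> {\<theta> \<in> A. h \<theta> \<sqsubseteq> g \<theta>}"
      using t by simp
  qed
  moreover have "{\<theta> \<in> A. g \<theta> \<sqsubseteq> f \<theta>} \<union> {\<theta> \<in> A. h \<theta> \<sqsubseteq> g \<theta>} \<in> J"
    using ideal_on_Un[OF assms(2)] assms(5,6) by (simp add: less_mod_def)
  ultimately show ?thesis
    unfolding less_mod_def using ideal_on_subset[OF assms(2)] by blast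
qed

lemma tcf:
  assumes "has_tcf A J"
  shows Ord_tcf: "Ord (tcf A J)"
    and increasing_cofinal_tcf: "\<exists>F. increasing_cofinal A J (tcf A J) F"
    and not_increasing_cofinal_less_tcf: "\<And>b F. b \<sqsubset> tcf A J \<Longrightarrow> \<not> increasing_cofinal A J b F"
proof -
  obtain a F where a: "Ord a" "increasing_cofinal A J a F" using assms by (auto simp: has_tcf_def)
  then have "\<exists>F. increasing_cofinal A J a F" by blast
  note L = ord_Least[of a "\<lambda>\<alpha>. \<exists>F. increasing_cofinal A J \<alpha> F", OF a(1) this, folded tcf_def]
  show "Ord (tcf A J)" "\<exists>F. increasing_cofinal A J (tcf A J) F" by (rule L)+
  show "\<And>b F. b \<sqsubset> tcf A J \<Longrightarrow> \<not> increasing_cofinal A J b F" using L(3) by blast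
qed

text \<open>Reindexing a cofinal sequence by a strictly increasing cofinal map gives one of length
  \<open>cofinality (tcf A J)\<close>, which the minimality of \<open>tcf\<close> forbids to be
  shorter.\<close>

lemma cofinality_tcf:
  assumes A: "A \<subseteq> Reg" and J: "ideal_on A J" and t: "has_tcf A J"
  shows "cofinality (tcf A J) = tcf A J"
proof -
  let ?l = "tcf A J"
  have Ol: "Ord ?l" using Ord_tcf t by blast
  have Oc: "Ord (cofinality ?l)" using Ord_cofinality Ol by blast
  obtain F where F: "increasing_cofinal A J ?l F" using increasing_cofinal_tcf t by blast
  obtain h where h: "h ` elts (cofinality ?l) \<subseteq> elts ?l"
      "\<forall>g \<in> elts ?l. \<exists>x \<in> elts (cofinality ?l). g \<sqsubseteq> h x"
    using ex_cofinal_map[OF Ol] by blast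
  define G where "G = strictify h"
  note G = strictify[OF Ol h(1), folded G_def]
  have "increasing_cofinal A J (cofinality ?l) (\<lambda>x. F (G x))"
    unfolding increasing_cofinal_def
  proof (intro conjI ballI)
    fix x assume x: "x \<sqsubset> cofinality ?l"
    show "F (G x) \<in> product A"
      using F G(1)[OF x] unfolding increasing_cofinal_def by blast
    fix y assume "y \<sqsubset> x"
    then show "less_mod A J (F (G y)) (F (G x))"
      using F G(1,3)[OF x] unfolding increasing_cofinal_def by blast
  next
    fix g assume g: "g \<in> product A"
    then obtain e where e: "e \<sqsubset> ?l" "less_mod A J g (F e)"
      using F unfolding increasing_cofinal_def by blast
    then obtain x where x: "x \<sqsubset> cofinality ?l" "e \<sqsubseteq> h x" using h(2) by blast
    have OG: "Ord (G x)" using G(1)[OF x(1)] Ol Ord_in_Ord by blast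
    have eG: "e \<sqsubseteq> G x" by (rule Ord_le_trans[OF OG x(2) G(2)[OF x(1)]])
    have "less_mod A J g (F (G x))"
    proof (cases "e = G x")
      case True
      then show ?thesis using e by simp
    next
      case False
      then have "less_mod A J (F e) (F (G x))"
        using F G(1)[OF x(1)] eG unfolding increasing_cofinal_def by blast
      moreover have "F e \<in> product A"
        using F e(1) unfolding increasing_cofinal_def by blast
      ultimately show ?thesis using less_mod_trans[OF A J g _ e(2)] by blast
    qed
    with x(1) show "\<exists>x \<in> elts (cofinality ?l). less_mod A J g (F (G x))" by blast
  qed
  then have "\<not> cofinality ?l \<sqsubset> ?l" using not_increasing_cofinal_less_tcf[OF t] by blast
  moreover have "cofinality ?l \<sqsubseteq> ?l"
    by (rule cofinality_le[of _ _ id]) (use Ol in auto)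
  ultimately show ?thesis by blast
qed

lemma Card_tcf:
  assumes "A \<subseteq> Reg" "ideal_on A J" "has_tcf A J"
  shows "Card (tcf A J)"
  using Card_if_cofinality_eq cofinality_tcf[OF assms] Ord_tcf assms(3) by blast

text \<open>By regularity, any sequence in the product is bounded in all coordinates beyond its length.\<close>

lemma coords_above_length_in_ideal:
  assumes A: "A \<subseteq> Reg" and J: "ideal_on A J" and F: "increasing_cofinal A J l F"
  shows "{\<theta> \<in> A. l \<sqsubset> \<theta>} \<in> J"
proof -
  have ex: "\<exists>g. g \<sqsubset> \<theta> \<and> (l \<sqsubset> \<theta> \<longrightarrow> (\<forall>x \<in> elts l. F x \<theta> \<sqsubset> g))" if t: "\<theta> \<in> A" for \<theta>
  proof (cases "l \<sqsubset> \<theta>")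
    case True
    have O: "Ord \<theta>" "l \<sqsubset> cofinality \<theta>" using A t True Reg_Ord by (auto simp: Reg_def)
    have "(\<lambda>x. F x \<theta>) ` elts l \<subseteq> elts \<theta>"
      using F t unfolding increasing_cofinal_def by (auto dest: PiE_mem)
    then show ?thesis using less_cofinality_bounded[OF O] by blast
  next
    case False
    \<comment> \<open>At the other coordinates any element of \<theta> serves as a default
      value.\<close>
    have "infinite (elts \<theta>)" using A t by (auto simp: Reg_def InfCard_def)
    then have "elts \<theta> \<noteq> {}" by auto
    then show ?thesis using False by blast
  qed
  then obtain g where g: "\<And>\<theta>. \<theta> \<in> A \<Longrightarrow> g \<theta> \<sqsubset> \<theta> \<and> (l \<sqsubset> \<theta> \<longrightarrow> (\<forall>x \<in> elts l. F x \<theta> \<sqsubset> g \<theta>))"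
    by metis
  have "restrict g A \<in> product A" using g by auto
  then obtain x where x: "x \<sqsubset> l" "less_mod A J (restrict g A) (F x)"
    using F unfolding increasing_cofinal_def by blast
  \<comment> \<open>At each coordinate above \<open>l\<close>, \<open>g\<close> exceeds the whole
    sequence, in particular \<open>F x\<close>, which nevertheless exceeds \<open>g\<close> modulo
    \<open>J\<close>.\<close>
  have "{\<theta> \<in> A. l \<sqsubset> \<theta>} \<subseteq> {\<theta> \<in> A. F x \<theta> \<sqsubseteq> restrict g A \<theta>}" using g x(1) by auto
  then show ?thesis using ideal_on_subset[OF J] x(2) unfolding less_mod_def by blast
qed

text \<open>As \<open>l\<close> is not in \<open>A\<close>, the coordinates below and above
  \<open>l\<close> make up all of \<open>A\<close>; both parts in \<open>J\<close> would make
  \<open>J\<close> improper.\<close>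

lemma coords_below_length_notin_ideal:
  assumes A: "A \<subseteq> Reg" and J: "proper_ideal_on A J" and F: "increasing_cofinal A J l F"
    and l: "Ord l" "l \<notin> A"
  shows "A \<inter> elts l \<notin> J"
proof
  assume "A \<inter> elts l \<in> J"
  have I: "ideal_on A J" using J by (simp add: proper_ideal_on_def)
  have "(A \<inter> elts l) \<union> {\<theta> \<in> A. l \<sqsubset> \<theta>} \<in> J"
    using ideal_on_Un[OF I] coords_above_length_in_ideal[OF A I F] \<open>A \<inter> elts l \<in> J\<close> by blast
  moreover have "A \<subseteq> (A \<inter> elts l) \<union> {\<theta> \<in> A. l \<sqsubset> \<theta>}"
    using A l Ord_linear[OF l(1)] Reg_Ord by blast
  ultimately show False using ideal_on_subset[OF I] J unfolding proper_ideal_on_def by blast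
qed

text \<open>It is enough that \<open>k\<close> bounds the trace of \<open>A\<close> below the true
  cofinality. Taking for \<open>k\<close> the least possible cofinality with a given trace serves
  its whole fibre.\<close>

lemma tcf_le_two_pow:
  assumes A: "A \<subseteq> Reg" and J: "proper_ideal_on A J" "has_tcf A J" "tcf A J \<notin> A"
    and k: "InfCard k" "A \<inter> elts (tcf A J) \<subseteq> elts k"
  shows "tcf A J \<sqsubseteq> two_pow k"
proof -
  let ?l = "tcf A J" and ?B = "A \<inter> elts (tcf A J)"
  have I: "ideal_on A J" using J(1) by (simp add: proper_ideal_on_def)
  obtain F where F: "increasing_cofinal A J ?l F" using increasing_cofinal_tcf J(2) by blast
  have Ol: "Ord ?l" using Ord_tcf J(2) by blast
  have Ok: "Ord k" using k(1) InfCard_Card Card_Ord by blast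
  have B: "?B \<notin> J" using coords_below_length_notin_ideal[OF A J(1) F Ol J(3)] .
  have diff: "\<exists>\<theta> \<in> ?B. F y \<theta> \<noteq> F x \<theta>" if "y \<sqsubset> x" "x \<sqsubset> ?l" for x y
  proof (rule ccontr)
    assume "\<not> ?thesis"
    then have "?B \<subseteq> {\<theta> \<in> A. F x \<theta> \<sqsubseteq> F y \<theta>}" by auto
    moreover have "{\<theta> \<in> A. F x \<theta> \<sqsubseteq> F y \<theta>} \<in> J"
      using F that unfolding increasing_cofinal_def less_mod_def by blast
    ultimately show False using ideal_on_subset[OF I] B by blast
  qed
  \<comment> \<open>Each \<open>F x\<close> is coded by its graph on the trace \<open>?B\<close>;
    since \<open>F x \<theta>\<close> is below \<theta>, the graph lies in the square of
    \<open>k\<close>.\<close>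
  define \<Gamma> where "\<Gamma> x = (\<lambda>\<theta>. (\<theta>, F x \<theta>)) ` ?B" for x
  have "inj_on \<Gamma> (elts ?l)"
  proof (rule inj_onI)
    fix x y assume xy: "x \<sqsubset> ?l" "y \<sqsubset> ?l" "\<Gamma> x = \<Gamma> y"
    have "F x \<theta> = F y \<theta>" if "\<theta> \<in> ?B" for \<theta>
    proof -
      have "(\<theta>, F x \<theta>) \<in> \<Gamma> y" using that xy(3) unfolding \<Gamma>_def by blast
      then show ?thesis by (auto simp: \<Gamma>_def)
    qed
    then show "x = y" using diff xy Ord_linear[of x y] Ol Ord_in_Ord by metis
  qed
  moreover have "\<Gamma> ` elts ?l \<subseteq> Pow (elts k \<times> elts k)"
  proof clarify
    fix x a b assume x: "x \<sqsubset> ?l" and "(a, b) \<in> \<Gamma> x"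
    then have ab: "a \<in> ?B" "b = F x a" by (auto simp: \<Gamma>_def)
    have "F x \<in> product A" using F x unfolding increasing_cofinal_def by blast
    then have "b \<sqsubset> a" using ab by (auto dest: PiE_mem)
    then show "a \<sqsubset> k \<and> b \<sqsubset> k" using ab(1) k(2) Ord_trans[OF Ok] by blast
  qed
  ultimately have "elts ?l \<lesssim> Pow (elts k \<times> elts k)" by (auto simp: lepoll_def)
  also have "Pow (elts k \<times> elts k) \<lesssim> Pow (elts k)"
  proof -
    obtain f where "inj_on f (elts k \<times> elts k)" "f ` (elts k \<times> elts k) \<subseteq> elts k"
      using infinite_Times_lepoll[of "elts k"] k(1) by (auto simp: InfCard_def lepoll_def)
    then show ?thesis
      unfolding lepoll_def by (intro exI[of _ "image f"]) (auto simp: inj_on_image_Pow)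
  qed
  also have "Pow (elts k) \<approx> elts (two_pow k)" using two_pow_eqpoll eqpoll_sym by blast
  finally show ?thesis
    using Card_lepoll_imp_le[OF Card_tcf[OF A I J(2)]] Card_two_pow Card_Ord by blast
qed

section \<open>Counting the possible cofinalities\<close>

lemma pcf_finite:
  assumes A: "A \<subseteq> Reg" and fin: "finite A"
  shows "pcf A \<subseteq> A"
proof
  fix l assume "l \<in> pcf A"
  then obtain J where J: "proper_ideal_on A J" "has_tcf A J" "l = tcf A J"
    by (auto simp: pcf_def)
  have I: "ideal_on A J" using J(1) by (simp add: proper_ideal_on_def)
  obtain F where F: "increasing_cofinal A J l F" using increasing_cofinal_tcf J by blast
  have Ol: "Ord l" using Ord_tcf J by blast
  show "l \<in> A"
  proof (rule ccontr)
    assume "l \<notin> A"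
    then have "A \<inter> elts l \<notin> J" using coords_below_length_notin_ideal[OF A J(1) F Ol] by blast
    \<comment> \<open>At such a coordinate no two members of the sequence agree, as their agreement
      would put the singleton of \<theta> into \<open>J\<close>.\<close>
    then obtain \<theta> where t: "\<theta> \<in> A" "\<theta> \<sqsubset> l" "{\<theta>} \<notin> J"
      using ideal_on_finite[OF I, of "A \<inter> elts l"] fin by blast
    have Fl: "F x \<theta> \<sqsubset> \<theta>" if "x \<sqsubset> l" for x
      using F that t(1) unfolding increasing_cofinal_def by (auto dest: PiE_mem)
    have "F y \<theta> \<noteq> F x \<theta>" if "y \<sqsubset> x" "x \<sqsubset> l" for x y
    proof
      assume "F y \<theta> = F x \<theta>"
      then have "{\<theta>} \<subseteq> {\<theta> \<in> A. F x \<theta> \<sqsubseteq> F y \<theta>}" using t(1) by auto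
      moreover have "{\<theta> \<in> A. F x \<theta> \<sqsubseteq> F y \<theta>} \<in> J"
        using F that unfolding increasing_cofinal_def less_mod_def by blast
      ultimately show False using ideal_on_subset[OF I] t(3) by blast
    qed
    then have "inj_on (\<lambda>x. F x \<theta>) (elts l)"
      by (intro inj_onI) (metis Ol Ord_in_Ord Ord_linear)
    then have "elts l \<lesssim> elts \<theta>" using Fl by (auto simp: lepoll_def)
    then have "l \<sqsubseteq> \<theta>"
      using Card_lepoll_imp_le Card_tcf[OF A I J(2)] J(3) t(1) A Reg_Ord by blast
    then show False using t(2) mem_irrefl mem_asym by blast
  qed
qed

text \<open>Outside \<open>A\<close>, possible cofinalities with the same trace on \<open>A\<close> lie between the least of
  them and its power, hence below the next limit cardinal.\<close>

lemma countable_pcf_fibre: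
  assumes lim: "\<forall>\<kappa>::'a::zfc. limit_cardinal \<kappa> \<longrightarrow> strong_limit_cardinal \<kappa>"
    and A: "A \<subseteq> (Reg :: 'a set)"
  shows "countable {l \<in> pcf A - A. A \<inter> elts l = X}"
proof (cases "{l \<in> pcf A - A. A \<inter> elts l = X} = {}")
  case False
  let ?S = "{l \<in> pcf A - A. A \<inter> elts l = X}"
  obtain k where k: "k \<in> ?S" "\<forall>c. c \<sqsubset> k \<longrightarrow> c \<notin> ?S"
    using False ex_least[of "\<lambda>l. l \<in> ?S"] by blast
  have C: "Card l" if l: "l \<in> pcf A" for l
  proof -
    obtain J where "proper_ideal_on A J" "has_tcf A J" "l = tcf A J"
      using l by (auto simp: pcf_def)
    then show ?thesis using Card_tcf[OF A, of J] by (simp add: proper_ideal_on_def)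
  qed
  obtain J where J: "proper_ideal_on A J" "has_tcf A J" "k = tcf A J"
    using k(1) by (auto simp: pcf_def)
  have Ok: "Ord k" using k(1) C Card_Ord by blast
  \<comment> \<open>The trace of \<open>A\<close> below \<open>k\<close> is outside
    \<open>J\<close>, hence nonempty; a regular cardinal below \<open>k\<close> makes
    \<open>k\<close> infinite.\<close>
  obtain F where "increasing_cofinal A J k F"
    using increasing_cofinal_tcf[OF J(2)] unfolding J(3) by blast
  then have "A \<inter> elts k \<notin> J"
    using coords_below_length_notin_ideal[OF A J(1) _ Ok] k(1) by simp
  moreover have "{} \<in> J" using J(1) by (auto simp: proper_ideal_on_def ideal_on_def)
  ultimately have "A \<inter> elts k \<noteq> {}" by metis
  then obtain \<theta> where "\<theta> \<in> A" "\<theta> \<sqsubset> k" by blast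
  then have "InfCard \<theta>" "\<theta> \<sqsubset> k" using A Reg_InfCard by blast+
  then have Ik: "InfCard k" using InfCard_mono[OF _ C] k(1) by blast
  have "?S \<subseteq> {l. Card l \<and> k \<sqsubseteq> l \<and> l \<sqsubseteq> two_pow k}"
  proof
    fix l assume l: "l \<in> ?S"
    then have Cl: "Card l" using C by blast
    then have "k \<sqsubseteq> l" using k(2) l Ord_linear[OF Card_Ord[OF Cl] Ok] by blast
    moreover have "l \<sqsubseteq> two_pow k"
    proof -
      obtain J where J: "proper_ideal_on A J" "has_tcf A J" "l = tcf A J"
        using l by (auto simp: pcf_def)
      \<comment> \<open>The trace is common to the fibre, so it lies below \<open>k\<close> even
        when \<open>l\<close> is larger.\<close>
      have "A \<inter> elts l = A \<inter> elts k" using l k(1) by simp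
      then have "A \<inter> elts l \<subseteq> elts k" by simp
      then show ?thesis using tcf_le_two_pow[OF A J(1,2) _ Ik] l J(3) by simp
    qed
    ultimately show "l \<in> {l. Card l \<and> k \<sqsubseteq> l \<and> l \<sqsubseteq> two_pow k}" using Cl by blast
  qed
  then show ?thesis by (rule countable_subset[OF _ countable_Card_interval[OF lim Ik]])
qed (simp only: countable_empty)

lemma pcf_lepoll:
  assumes lim: "\<forall>\<kappa>::'a::zfc. limit_cardinal \<kappa> \<longrightarrow> strong_limit_cardinal \<kappa>"
    and A: "A \<subseteq> (Reg :: 'a set)"
  shows "pcf A \<lesssim> A"
proof (cases "finite A")
  case True
  then show ?thesis by (rule subset_imp_lepoll[OF pcf_finite[OF A]])
next
  case False
  define fib where "fib X = {l \<in> pcf A - A. A \<inter> elts l = X}" for X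
  \<comment> \<open>A trace of some \<open>l\<close> outside \<open>A\<close> is either all of
    \<open>A\<close> or \<open>A \<inter> elts \<theta>\<close> for the least \<theta> in
    \<open>A\<close> not below \<open>l\<close>. Adding \<open>fib A\<close> to every
    \<open>U \<theta>\<close> lets \<open>A\<close> alone serve as index set.\<close>
  define U where "U \<theta> = {\<theta>} \<union> fib (A \<inter> elts \<theta>) \<union> fib A" for \<theta>
  have "countable (U \<theta>)" for \<theta>
    using countable_pcf_fibre[OF lim A] by (simp add: U_def fib_def)
  then have "U \<theta> \<lesssim> (UNIV::nat set)" for \<theta> by (auto simp: countable_def lepoll_def)
  moreover have "(UNIV::nat set) \<lesssim> A" using False by (simp add: infinite_le_lepoll)
  ultimately have "U \<theta> \<lesssim> A" for \<theta> by (rule lepoll_trans)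
  then have "|U \<theta>| \<le>o |A|" for \<theta> unfolding lepoll_def card_of_ordLeq .
  then have "|\<Union>\<theta> \<in> A. U \<theta>| \<le>o |A|"
    by (intro card_of_UNION_ordLeq_infinite[OF False]) (simp_all add: card_of_mono1)
  then have "(\<Union>\<theta> \<in> A. U \<theta>) \<lesssim> A" unfolding lepoll_def card_of_ordLeq .
  moreover have "pcf A \<subseteq> (\<Union>\<theta> \<in> A. U \<theta>)"
  proof
    fix l assume l: "l \<in> pcf A"
    have Ol: "Ord l" using l Ord_tcf by (auto simp: pcf_def)
    consider "l \<in> A" | "l \<notin> A" "A \<subseteq> elts l" | "l \<notin> A" "\<exists>\<theta>. \<theta> \<in> A - elts l" by blast
    then show "l \<in> (\<Union>\<theta> \<in> A. U \<theta>)"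
    proof cases
      case 1
      then show ?thesis by (auto simp: U_def)
    next
      case 2
      then have "l \<in> fib A" using l by (auto simp: fib_def)
      moreover obtain \<theta> where "\<theta> \<in> A" using False by (metis ex_in_conv finite.emptyI)
      ultimately show ?thesis by (auto simp: U_def)
    next
      case 3
      then obtain \<theta> where t: "\<theta> \<in> A - elts l" "\<forall>c. c \<sqsubset> \<theta> \<longrightarrow> c \<notin> A - elts l"
        using ex_least[of "\<lambda>\<theta>. \<theta> \<in> A - elts l"] by blast
      then have Ot: "Ord \<theta>" using A Reg_Ord by blast
      have "l \<sqsubseteq> \<theta>" using Ord_linear[OF Ol Ot] t(1) by blast
      then have "A \<inter> elts l = A \<inter> elts \<theta>" using t(2) Ord_less_le_trans[OF Ot] by blast
      then have "l \<in> fib (A \<inter> elts \<theta>)" using l 3 by (auto simp: fib_def)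
      then show ?thesis using t(1) by (auto simp: U_def)
    qed
  qed
  ultimately show ?thesis using lepoll_trans[OF subset_imp_lepoll] by blast
qed

section \<open>Singular cardinals and the final assembly\<close>

text \<open>The supremum of the iterated successors of a large \<open>k\<close> has a cofinal
  sequence indexed by the countable \<open>w\<close>, while it exceeds \<open>w\<close>
  itself.\<close>

lemma ex_singular_above:
  assumes "small (S::'a::zfc set)" "\<And>x. x \<in> S \<Longrightarrow> Ord x"
  shows "\<exists>m. singular_cardinal m \<and> (\<forall>x \<in> S. x \<sqsubset> m)"
proof -
  obtain w :: 'a where w: "InfCard w" "elts w \<approx> (UNIV::nat set)"
    using ex_countable_InfCard by blast
  have Ow: "Ord w" using w InfCard_Card Card_Ord by blast
  obtain b where b: "Ord b" "\<forall>x \<in> S. x \<sqsubset> b" using ex_Ord_above assms by blast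
  have "small {b, w}" by (simp add: small_countable)
  then obtain d where d: "Ord d" "b \<sqsubset> d" "w \<sqsubset> d"
    using ex_Ord_above[of "{b, w}"] b(1) Ow by auto
  obtain k where k: "Card k" "d \<sqsubset> k" using ex_Card_above d(1) by blast
  have Ok: "Ord k" using k(1) Card_Ord by blast
  have bw: "b \<sqsubset> k" "w \<sqsubset> k" using d k(2) Ord_trans[OF Ok] by blast+
  have Ik: "InfCard k" using InfCard_mono w(1) k(1) bw(2) by blast
  obtain m where m: "limit_cardinal m" "elts m = (\<Union>n. elts ((card_succ ^^ n) k))"
    using ex_limit_cardinal_Sup[OF Ik] by blast
  have Im: "InfCard m" using m(1) by (simp add: limit_cardinal_def)
  have Om: "Ord m" using Im InfCard_Card Card_Ord by blast
  have cm: "(card_succ ^^ n) k \<sqsubset> m" for n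
  proof -
    have "(card_succ ^^ n) k \<sqsubset> (card_succ ^^ Suc n) k"
      using less_card_succ[OF Card_Ord[OF Card_card_succ_funpow[OF k(1)]]] by simp
    then show ?thesis using m(2) by blast
  qed
  have km: "k \<sqsubset> m" using cm[of 0] by simp
  obtain f where f: "bij_betw f (elts w) (UNIV::nat set)" using w(2) by (auto simp: eqpoll_def)
  have "cofinality m \<sqsubseteq> w"
  proof (rule cofinality_le[OF Om Ow])
    show "(\<lambda>x. (card_succ ^^ f x) k) ` elts w \<subseteq> elts m" using cm by blast
    show "\<forall>g \<in> elts m. \<exists>x \<in> elts w. g \<sqsubseteq> (card_succ ^^ f x) k"
    proof
      fix g assume "g \<sqsubset> m"
      then obtain n where n: "g \<sqsubset> (card_succ ^^ n) k" using m(2) by blast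
      obtain x where "x \<sqsubset> w" "f x = n" using f by (metis UNIV_I bij_betw_imp_surj_on imageE)
      then show "\<exists>x \<in> elts w. g \<sqsubseteq> (card_succ ^^ f x) k" using n by blast
    qed
  qed
  moreover have "w \<sqsubset> m" using Ord_trans[OF Om bw(2) km] .
  ultimately have "cofinality m \<sqsubset> m" by (rule Ord_le_less_trans[OF Om])
  moreover have "x \<sqsubset> m" if "x \<in> S" for x
    using Ord_trans[OF Om _ Ord_trans[OF Om bw(1) km]] b(2) that by blast
  ultimately show ?thesis using Im by (auto simp: singular_cardinal_def)
qed

theorem theorem4p3:
  assumes "\<forall>\<kappa>::'v::zfc. limit_cardinal \<kappa> \<longrightarrow> strong_limit_cardinal \<kappa>"
  shows "\<exists>C::'v set.
    (\<forall>\<kappa> \<in> C. singular_cardinal \<kappa>) \<and>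
    (\<forall>\<kappa>\<^sub>0. Card \<kappa>\<^sub>0 \<longrightarrow> (\<exists>\<kappa> \<in> C. \<kappa>\<^sub>0 \<sqsubset> \<kappa>)) \<and>
    (\<forall>\<delta>. Ord \<delta> \<and> aleph \<delta> \<in> C \<longrightarrow>
       (\<forall>A. A \<subseteq> Reg \<inter> elts (aleph \<delta>) \<and> progressive A \<longrightarrow>
          cardinality (pcf A) \<sqsubset> (card_succ ^^ 3) (cardinality A))) \<and>
    (\<forall>\<delta>. Ord \<delta> \<and> aleph \<delta> \<in> C \<longrightarrow>
       two_pow (aleph \<delta>) \<sqsubset> aleph ((card_succ ^^ 3) (cardinality (elts \<delta>))))"
proof -
  obtain w :: 'v where w: "InfCard w" using ex_countable_InfCard by blast
  have Ow: "Ord w" using w InfCard_Card Card_Ord by blast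
  let ?C = "{\<kappa>. singular_cardinal \<kappa> \<and> aleph w \<sqsubset> \<kappa>}"
  have "\<exists>\<kappa> \<in> ?C. \<kappa>\<^sub>0 \<sqsubset> \<kappa>" if "Card \<kappa>\<^sub>0" for \<kappa>\<^sub>0
  proof -
    have "small {\<kappa>\<^sub>0, aleph w}" by (simp add: small_countable)
    moreover have "Ord x" if "x \<in> {\<kappa>\<^sub>0, aleph w}" for x
      using that \<open>Card \<kappa>\<^sub>0\<close> InfCard_aleph[OF Ow] InfCard_Card Card_Ord by blast
    ultimately show ?thesis using ex_singular_above[of "{\<kappa>\<^sub>0, aleph w}"] by blast
  qed
  moreover have "cardinality (pcf A) \<sqsubset> (card_succ ^^ 3) (cardinality A)"
    if A: "A \<subseteq> Reg \<inter> elts (aleph \<delta>)" for A and \<delta> :: 'v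
  proof -
    have s: "small A" using A small_subset[OF small_elts] by blast
    have C: "Card (cardinality A)" by (rule Card_cardinality[OF s])
    have "cardinality (pcf A) \<sqsubseteq> cardinality A"
      using cardinality_mono[OF s] pcf_lepoll[OF assms] A by blast
    \<comment> \<open>The instance 2 yields the third successor, the lemma being stated for
      \<open>Suc n\<close>; it covers finite cardinals as well.\<close>
    moreover have "cardinality A \<sqsubset> (card_succ ^^ 3) (cardinality A)"
      using less_card_succ_funpow[OF C, of 2] by (simp add: numeral_3_eq_3 numeral_2_eq_2)
    ultimately show ?thesis
      by (rule Ord_le_less_trans[OF Card_Ord[OF Card_card_succ_funpow[OF C]]])
  qed
  moreover have "two_pow (aleph \<delta>) \<sqsubset> aleph ((card_succ ^^ 3) (cardinality (elts \<delta>)))"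
    if d: "Ord \<delta>" "aleph \<delta> \<in> ?C" for \<delta>
  proof -
    let ?d = "cardinality (elts \<delta>)"
    let ?n = "(card_succ ^^ 3) ?d"
    \<comment> \<open>Passing the threshold \<open>aleph w\<close> makes \<delta> infinite, so that
      \<open>?n\<close> is an infinite cardinal and \<open>aleph ?n\<close> a limit
      cardinal.\<close>
    have "w \<sqsubset> \<delta>" using aleph_less_imp[OF Ow d(1)] d(2) by blast
    then have "elts w \<subseteq> elts \<delta>" using Ord_subset_iff[OF Ow d(1)] by blast
    then have "infinite (elts \<delta>)" using w finite_subset unfolding InfCard_def by blast
    moreover have eq: "elts ?d \<approx> elts \<delta>" by (rule cardinality_eqpoll[OF small_elts])
    ultimately have Id: "InfCard ?d"
      using Card_cardinality[OF small_elts] eqpoll_finite_iff unfolding InfCard_def by blast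
    have In: "InfCard ?n" by (rule InfCard_card_succ_funpow[OF Id])
    have Cn: "Card ?n" "Ord ?n" using In InfCard_Card Card_Ord by blast+
    have dn: "?d \<sqsubset> ?n"
      using less_card_succ_funpow[OF InfCard_Card[OF Id], of 2]
      by (simp add: numeral_3_eq_3 numeral_2_eq_2)
    \<comment> \<open>Though \<delta> may exceed its cardinality \<open>?d\<close>, it stays below
      every cardinal larger than \<open>?d\<close>.\<close>
    have "\<delta> \<sqsubset> ?n"
    proof (rule ccontr)
      assume "\<not> \<delta> \<sqsubset> ?n"
      then have "elts ?n \<subseteq> elts \<delta>" using Ord_not_less Ord_subset_iff Cn(2) d(1) by blast
      then have "elts ?n \<lesssim> elts ?d"
        using subset_imp_lepoll lepoll_trans2 eqpoll_sym[OF eq] by blast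
      then have "?n \<sqsubseteq> ?d" using Card_lepoll_imp_le Cn(1) InfCard_Card[OF Id] Card_Ord by blast
      then show False using dn by (metis mem_irrefl mem_asym)
    qed
    then have "aleph \<delta> \<sqsubset> aleph ?n" by (rule aleph_less[OF Cn(2)])
    moreover have "strong_limit_cardinal (aleph ?n)" using assms limit_cardinal_aleph[OF In] by blast
    moreover have "Card (aleph \<delta>)" using InfCard_aleph[OF d(1)] InfCard_Card by blast
    ultimately show ?thesis unfolding strong_limit_cardinal_def by blast
  qed
  ultimately show ?thesis by (intro exI[of _ ?C]) blast
qed

end
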